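(* Let $G=(V,E)$ be an undirected graph with positive edge weights $c:E\to\mathbb{R}_{+}$, let $t\ge1$, and let $T_\ell\subseteq\cdots\subseteq T_1\subseteq V$ be nested terminal sets. Let $\mathrm{TOP}$ be the cost of the solution produced by the oracle top-down algorithm and $\mathrm{BOT}$ the cost of the solution produced by the oracle bottom-up algorithm (both described below), and let $\mathrm{OPT}$ be the cost of an optimal MLGS solution. Then $\min(\mathrm{TOP},\mathrm{BOT})\le\frac{\ell+2}{3}\,\mathrm{OPT}$.
   Context: For a weighted graph $G$, $d_G(u,v)$ denotes the length of a shortest $u$–$v$ path in $G$ with respect to $c$. Given $S\subseteq V$ and $t\ge1$, a subgraph $H$ of $G$ is a subsetwise $(S\times S)$-spanner of $G$ with stretch factor $t$ if $d_H(u,v)\le t\cdot d_G(u,v)$ for all $u,v\in S$; its cost is the sum of the weights of its edges. The multi-level graph spanner (MLGS) problem: given $G$, $c$, nested terminals $T_\ell\subseteq\cdots\subseteq T_1\subseteq V$ and $t\ge1$, find subgraphs $G_\ell\subseteq\cdots\subseteq G_1$ of $G$ such that each $G_i$ is a subsetwise $(T_i\times T_i)$-spanner of $G$ with stretch factor $t$, minimizing the cost $\sum_{i=1}^{\ell}\sum_{e\in E(G_i)}c_e$. Oracle top-down algorithm: $G_\ell$ is a minimum-cost subsetwise $(T_\ell\times T_\ell)$-spanner with stretch $t$, and for $i=\ell-1,\dots,1$, $G_i$ is the union of $G_{i+1}$ with a minimum-cost subsetwise $(T_i\times T_i)$-spanner with stretch $t$; $\mathrm{TOP}=\sum_i\sum_{e\in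 E(G_i)}c_e$. Oracle bottom-up algorithm: let $H$ be a minimum-cost subsetwise $(T_1\times T_1)$-spanner with stretch $t$; output $G_1=H$ and $G_\ell\subseteq\cdots\subseteq G_2\subseteq H$, either $G_i=H$ for all $i$ or obtained by pruning edges of $H$ so that each $G_i$ remains a subsetwise $(T_i\times T_i)$-spanner with stretch $t$; $\mathrm{BOT}=\sum_i\sum_{e\in E(G_i)}c_e$. *)

theory Defs
  imports "HOL-Library.Extended_Real"
begin

record 'a graph =
  verts :: "'a set"
  edges :: "'a set set"

definition finite_simple_graph :: "'a graph \<Rightarrow> bool" where
  "finite_simple_graph G \<longleftrightarrow>
     finite (verts G) \<and> (\<forall>e\<in>edges G. e \<subseteq> verts G \<and> card e = 2)"

definition subgraph :: "'a graph \<Rightarrow> 'a graph \<Rightarrow> bool" where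
  "subgraph H G \<longleftrightarrow>
     finite_simple_graph H \<and> verts H \<subseteq> verts G \<and> edges H \<subseteq> edges G"

definition graph_union :: "'a graph \<Rightarrow> 'a graph \<Rightarrow> 'a graph" where
  "graph_union G H = \<lparr>verts = verts G \<union> verts H, edges = edges G \<union> edges H\<rparr>"

(* The one-vertex list [u] is a u-u path of length 0, provided that u is a vertex. *)
definition is_path :: "'a graph \<Rightarrow> 'a \<Rightarrow> 'a list \<Rightarrow> 'a \<Rightarrow> bool" where
  "is_path G u p v \<longleftrightarrow>
     p \<noteq> [] \<and> hd p = u \<and> last p = v \<and> distinct p \<and> set p \<subseteq> verts G \<and>
     successively (\<lambda>x y. {x, y} \<in> edges G) p"

fun path_length :: "('a set \<Rightarrow> real) \<Rightarrow> 'a list \<Rightarrow> real" where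
  "path_length c (x # y # p) = c {x, y} + path_length c (y # p)"
| "path_length c _ = 0"

(* Infinite if there is no u-v path; in particular if u or v is not a vertex of G.
   A finite graph has finitely many paths, so otherwise the infimum is a minimum. *)
definition graph_dist :: "('a set \<Rightarrow> real) \<Rightarrow> 'a graph \<Rightarrow> 'a \<Rightarrow> 'a \<Rightarrow> ereal" where
  "graph_dist c G u v = (INF p\<in>{p. is_path G u p v}. ereal (path_length c p))"

definition graph_cost :: "('a set \<Rightarrow> real) \<Rightarrow> 'a graph \<Rightarrow> real" where
  "graph_cost c G = (\<Sum>e\<in>edges G. c e)"

definition subset_spanner ::
    "('a set \<Rightarrow> real) \<Rightarrow> 'a graph \<Rightarrow> real \<Rightarrow> 'a set \<Rightarrow> 'a graph \<Rightarrow> bool" where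
  "subset_spanner c G t S H \<longleftrightarrow>
     subgraph H G \<and>
     (\<forall>u\<in>S. \<forall>v\<in>S. graph_dist c H u v \<le> ereal t * graph_dist c G u v)"

definition min_cost_subset_spanner ::
    "('a set \<Rightarrow> real) \<Rightarrow> 'a graph \<Rightarrow> real \<Rightarrow> 'a set \<Rightarrow> 'a graph \<Rightarrow> bool" where
  "min_cost_subset_spanner c G t S H \<longleftrightarrow>
     is_arg_min (graph_cost c) (subset_spanner c G t S) H"

(* A family of l levels is a function on nat, of which only the values at 1, ..., l matter. *)
definition mlgs_solution ::
    "('a set \<Rightarrow> real) \<Rightarrow> 'a graph \<Rightarrow> real \<Rightarrow> nat \<Rightarrow> (nat \<Rightarrow> 'a set) \<Rightarrow> (nat \<Rightarrow> 'a graph) \<Rightarrow> bool"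
  where
  "mlgs_solution c G t l T Gs \<longleftrightarrow>
     (\<forall>i\<in>{1..l}. subset_spanner c G t (T i) (Gs i)) \<and>
     (\<forall>i\<in>{1..<l}. subgraph (Gs (Suc i)) (Gs i))"

definition mlgs_cost :: "('a set \<Rightarrow> real) \<Rightarrow> nat \<Rightarrow> (nat \<Rightarrow> 'a graph) \<Rightarrow> real" where
  "mlgs_cost c l Gs = (\<Sum>i=1..l. graph_cost c (Gs i))"

definition mlgs_optimal ::
    "('a set \<Rightarrow> real) \<Rightarrow> 'a graph \<Rightarrow> real \<Rightarrow> nat \<Rightarrow> (nat \<Rightarrow> 'a set) \<Rightarrow> (nat \<Rightarrow> 'a graph) \<Rightarrow> bool"
  where
  "mlgs_optimal c G t l T Gs \<longleftrightarrow>
     is_arg_min (mlgs_cost c l) (mlgs_solution c G t l T) Gs"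

(* The oracle may return any minimum-cost spanner and the pruning is not fixed, so the outputs
   of the two algorithms are described by relations: Gs is a possible output. *)
definition top_down_output ::
    "('a set \<Rightarrow> real) \<Rightarrow> 'a graph \<Rightarrow> real \<Rightarrow> nat \<Rightarrow> (nat \<Rightarrow> 'a set) \<Rightarrow> (nat \<Rightarrow> 'a graph) \<Rightarrow> bool"
  where
  "top_down_output c G t l T Gs \<longleftrightarrow>
     min_cost_subset_spanner c G t (T l) (Gs l) \<and>
     (\<forall>i\<in>{1..<l}. \<exists>H. min_cost_subset_spanner c G t (T i) H \<and>
                       Gs i = graph_union (Gs (Suc i)) H)"

definition bottom_up_output ::
    "('a set \<Rightarrow> real) \<Rightarrow> 'a graph \<Rightarrow> real \<Rightarrow> nat \<Rightarrow> (nat \<Rightarrow> 'a set) \<Rightarrow> (nat \<Rightarrow> 'a graph) \<Rightarrow> bool"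
  where
  "bottom_up_output c G t l T Gs \<longleftrightarrow>
     (\<exists>H. min_cost_subset_spanner c G t (T 1) H \<and> Gs 1 = H \<and>
        ((\<forall>i\<in>{1..l}. Gs i = H) \<or>
         (\<forall>i\<in>{1..<l}. subgraph (Gs (Suc i)) (Gs i) \<and>
                       subset_spanner c G t (T (Suc i)) (Gs (Suc i)))))"

end

theory Submission
  imports Defs
begin

text \<open>
  Let \<open>m i\<close> be the minimum cost of a \<open>(T i \<times> T i)\<close>-spanner; it decreases in \<open>i\<close> because the
  terminal sets are nested. Then \<open>TOP \<le> (\<Sum>i. i * m i)\<close>, \<open>BOT \<le> l * m 1\<close> and
  \<open>(\<Sum>i. m i) \<le> OPT\<close>. Hence \<open>2 * TOP + BOT \<le> (l + 2) * OPT\<close>, which bounds the minimum,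
  follows from \<open>(\<Sum>i=2..l. (l + 2 - 2 * i) * m i) \<ge> 0\<close>: the reflection \<open>i \<mapsto> l + 2 - i\<close> pairs
  opposite coefficients, the positive one going with the larger value of \<open>m\<close>.
\<close>

lemma finite_edges: "finite_simple_graph G \<Longrightarrow> finite (edges G)"
  unfolding finite_simple_graph_def by (rule finite_subset[of _ "Pow (verts G)"]) auto

lemma graph_cost_mono:
  assumes "finite (edges G)" and "edges H \<subseteq> edges G"
    and "\<And>e. e \<in> edges G \<Longrightarrow> c e \<ge> 0"
  shows "graph_cost c H \<le> graph_cost c G"
  unfolding graph_cost_def using assms by (intro sum_mono2) auto

text \<open>The right-hand side counts each common edge twice and the left-hand side once, so the
  sign condition concerns common edges.\<close>

lemma graph_cost_union_le:
  assumes "finite (edges G)" "finite (edges H)"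
    and "\<And>e. e \<in> edges G \<inter> edges H \<Longrightarrow> c e \<ge> 0"
  shows "graph_cost c (graph_union G H) \<le> graph_cost c G + graph_cost c H"
proof -
  have "sum c (edges G \<inter> edges H) \<ge> 0"
    using assms(3) by (rule sum_nonneg)
  then show ?thesis
    using sum_Un[OF assms(1,2), of c] by (simp add: graph_cost_def graph_union_def)
qed

lemma subset_spanner_subset:
  "subset_spanner c G t S H \<Longrightarrow> S' \<subseteq> S \<Longrightarrow> subset_spanner c G t S' H"
  unfolding subset_spanner_def by blast

lemma min_cost_subset_spanner_le:
  "min_cost_subset_spanner c G t S H \<Longrightarrow> subset_spanner c G t S H' \<Longrightarrow>
     graph_cost c H \<le> graph_cost c H'"
  unfolding min_cost_subset_spanner_def is_arg_min_linorder by blast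

lemma subset_spanner_edges: "subset_spanner c G t S H \<Longrightarrow> edges H \<subseteq> edges G"
  unfolding subset_spanner_def subgraph_def by blast

lemma min_cost_subset_spanner_imp_subset_spanner:
  "min_cost_subset_spanner c G t S H \<Longrightarrow> subset_spanner c G t S H"
  unfolding min_cost_subset_spanner_def is_arg_min_linorder by blast

text \<open>Exchange of summation: \<open>m j\<close> occurs in the tails starting at
  \<open>1, ..., j\<close>. Level \<open>i\<close> of the top-down solution pays for the spanners of
  levels \<open>i, ..., l\<close>, which is how these tails arise.\<close>

lemma sum_tail_sums:
  fixes m :: "nat \<Rightarrow> real"
  shows "(\<Sum>i=1..l. \<Sum>j=i..l. m j) = (\<Sum>j=1..l. real j * m j)"
proof (induction l)
  case (Suc l)
  have "(\<Sum>i=1..Suc l. \<Sum>j=i..Suc l. m j) = (\<Sum>i=1..Suc l. (\<Sum>j=i..l. m j) + m (Suc l))"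
    by (intro sum.cong) auto
  then show ?case
    using Suc by (simp add: sum.distrib algebra_simps)
qed simp

lemma centred_sum_nonneg:
  fixes m :: "nat \<Rightarrow> real"
  assumes anti: "\<And>i j. 2 \<le> i \<Longrightarrow> i \<le> j \<Longrightarrow> j \<le> l \<Longrightarrow> m j \<le> m i"
  shows "(\<Sum>i=2..l. (real l + 2 - 2 * real i) * m i) \<ge> 0"
proof -
  let ?S = "\<Sum>i=2..l. (real l + 2 - 2 * real i) * m i"
  \<comment> \<open>The interval \<open>{2..l}\<close> is invariant under the reflection, and
    \<open>i \<le> l\<close> keeps the subtraction on naturals from truncating. The coefficient
    changes sign, so adding both forms of \<open>?S\<close> leaves differences of
    \<open>m\<close>.\<close>
  have "?S = (\<Sum>i=2..l. (real l + 2 - 2 * real (l + 2 - i)) * m (l + 2 - i))"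
    by (subst sum.atLeastAtMost_rev) (simp add: add.commute)
  also have "\<dots> = (\<Sum>i=2..l. - ((real l + 2 - 2 * real i) * m (l + 2 - i)))"
    by (intro sum.cong) (auto simp: of_nat_diff algebra_simps)
  finally have "2 * ?S = (\<Sum>i=2..l. (real l + 2 - 2 * real i) * (m i - m (l + 2 - i)))"
    by (simp add: sum_negf sum_subtractf right_diff_distrib)
  also have "\<dots> \<ge> 0"
  proof (rule sum_nonneg)
    fix i assume i: "i \<in> {2..l}"
    \<comment> \<open>The coefficient is nonnegative exactly when \<open>i \<le> l + 2 - i\<close>,
      and then monotonicity makes the difference nonnegative; otherwise both factors are
      nonpositive.\<close>
    show "(real l + 2 - 2 * real i) * (m i - m (l + 2 - i)) \<ge> 0"
    proof (cases "2 * i \<le> l + 2")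
      case True
      then show ?thesis
        using anti[of i "l + 2 - i"] i by (intro mult_nonneg_nonneg) auto
    next
      case False
      then show ?thesis
        using anti[of "l + 2 - i" i] i by (intro mult_nonpos_nonpos) auto
    qed
  qed
  finally show ?thesis by simp
qed

text \<open>At index 1 the coefficient \<open>l + 2 - 2 * i\<close> equals \<open>l\<close>, which
  the term \<open>real l * m 1\<close> cancels. What remains is the range \<open>{2..l}\<close>,
  symmetric about \<open>(l + 2) / 2\<close>.\<close>

lemma weighted_sum_le:
  fixes m :: "nat \<Rightarrow> real"
  assumes "l \<ge> 1" and "\<And>i j. 1 \<le> i \<Longrightarrow> i \<le> j \<Longrightarrow> j \<le> l \<Longrightarrow> m j \<le> m i"
  shows "2 * (\<Sum>j=1..l. real j * m j) + real l * m 1 \<le> (real l + 2) * (\<Sum>j=1..l. m j)"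
proof -
  have "0 \<le> (\<Sum>i=2..l. (real l + 2 - 2 * real i) * m i)"
    using assms(2) by (intro centred_sum_nonneg) auto
  also have "\<dots> = (\<Sum>i=1..l. (real l + 2 - 2 * real i) * m i) - real l * m 1"
    using sum.atLeast_Suc_atMost[OF assms(1), of "\<lambda>i. (real l + 2 - 2 * real i) * m i"]
    by (simp add: numeral_2_eq_2)
  also have "(\<Sum>i=1..l. (real l + 2 - 2 * real i) * m i)
      = (real l + 2) * (\<Sum>j=1..l. m j) - 2 * (\<Sum>j=1..l. real j * m j)"
    by (simp add: sum_distrib_left sum_subtractf left_diff_distrib mult.assoc)
  finally show ?thesis by simp
qed

text \<open>With or without pruning, every level keeps its edges inside those of
  \<open>BU 1\<close>, so each of the \<open>l\<close> levels costs at most as much as level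
  1.\<close>

lemma bottom_up_cost_le:
  assumes out: "bottom_up_output c G t l T BU" and fin: "finite (edges G)"
    and nonneg: "\<And>e. e \<in> edges G \<Longrightarrow> c e \<ge> 0"
  shows "mlgs_cost c l BU \<le> real l * graph_cost c (BU 1)"
proof -
  have sp: "subset_spanner c G t (T 1) (BU 1)"
    and cases: "(\<forall>i\<in>{1..l}. BU i = BU 1) \<or> (\<forall>i\<in>{1..<l}. edges (BU (Suc i)) \<subseteq> edges (BU i))"
    using out min_cost_subset_spanner_imp_subset_spanner
    unfolding bottom_up_output_def subgraph_def by blast+
  have "edges (BU i) \<subseteq> edges (BU 1)" if "1 \<le> i" "i \<le> l" for i
    using cases
  proof
    assume "\<forall>i\<in>{1..l}. BU i = BU 1"
    then show ?thesis using that by (metis atLeastAtMost_iff order_refl)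
  next
    assume chain: "\<forall>i\<in>{1..<l}. edges (BU (Suc i)) \<subseteq> edges (BU i)"
    show ?thesis using that
    proof (induction i rule: dec_induct)
      case (step n)
      then have "edges (BU (Suc n)) \<subseteq> edges (BU n)" using chain by simp
      then show ?case using step by simp
    qed simp
  qed
  then have "graph_cost c (BU i) \<le> graph_cost c (BU 1)" if "i \<in> {1..l}" for i
    using that nonneg subset_spanner_edges[OF sp] fin
    by (intro graph_cost_mono) (auto intro: finite_subset)
  then show ?thesis
    using sum_bounded_above[of "{1..l}" "\<lambda>i. graph_cost c (BU i)" "graph_cost c (BU 1)"]
    by (simp add: mlgs_cost_def)
qed

lemma top_down_cost_le:
  assumes union: "\<And>i. i \<in> {1..<l} \<Longrightarrow> TD i = graph_union (TD (Suc i)) (H i)"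
    and base: "TD l = H l"
    and sub: "\<And>i. i \<in> {1..l} \<Longrightarrow> edges (H i) \<subseteq> edges G" and fin: "finite (edges G)"
    and nonneg: "\<And>e. e \<in> edges G \<Longrightarrow> c e \<ge> 0"
  shows "mlgs_cost c l TD \<le> (\<Sum>j=1..l. real j * graph_cost c (H j))"
proof -
  \<comment> \<open>The edge inclusion is carried through the downward induction because it supplies
    the finiteness and the nonnegative weights for the union bound.\<close>
  have level: "edges (TD i) \<subseteq> edges G \<and> graph_cost c (TD i) \<le> (\<Sum>j=i..l. graph_cost c (H j))"
    if "i \<le> l" "1 \<le> i" for i
    using that
  proof (induction i rule: inc_induct)
    case base
    then show ?case using assms(2) sub by auto
  next
    case (step n)
    have IH: "edges (TD (Suc n)) \<subseteq> edges G"
      "graph_cost c (TD (Suc n)) \<le> (\<Sum>j=Suc n..l. graph_cost c (H j))"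
      using step by auto
    have eq: "TD n = graph_union (TD (Suc n)) (H n)" and Hn: "edges (H n) \<subseteq> edges G"
      using union sub step by auto
    have "graph_cost c (TD n) \<le> graph_cost c (TD (Suc n)) + graph_cost c (H n)"
      unfolding eq using IH(1) Hn fin nonneg
      by (intro graph_cost_union_le) (auto intro: finite_subset)
    also have "\<dots> \<le> (\<Sum>j=n..l. graph_cost c (H j))"
      using IH(2) step.hyps by (simp add: sum.atLeast_Suc_atMost)
    finally show ?case
      using IH(1) Hn by (simp add: eq graph_union_def)
  qed
  have "mlgs_cost c l TD \<le> (\<Sum>i=1..l. \<Sum>j=i..l. graph_cost c (H j))"
    unfolding mlgs_cost_def using level by (intro sum_mono) auto
  then show ?thesis by (simp only: sum_tail_sums)
qed

theorem theorem4:
  fixes G :: "'a graph" and c :: "'a set \<Rightarrow> real" and t :: real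
    and l :: nat and T :: "nat \<Rightarrow> 'a set"
    and TD BU Opt :: "nat \<Rightarrow> 'a graph"
  assumes "finite_simple_graph G"
    and "\<And>e. e \<in> edges G \<Longrightarrow> c e > 0"
    and "t \<ge> 1"
    and "l \<ge> 1"
    and "T 1 \<subseteq> verts G"
    and "\<And>i. i \<in> {1..<l} \<Longrightarrow> T (Suc i) \<subseteq> T i"
    and "top_down_output c G t l T TD"
    and "bottom_up_output c G t l T BU"
    and "mlgs_optimal c G t l T Opt"
  shows "min (mlgs_cost c l TD) (mlgs_cost c l BU)
           \<le> (real l + 2) / 3 * mlgs_cost c l Opt"
proof -
  have fin: "finite (edges G)" and nonneg: "\<And>e. e \<in> edges G \<Longrightarrow> c e \<ge> 0"
    using assms(1,2) finite_edges by (auto intro: less_imp_le)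
  \<comment> \<open>The conditional treats level \<open>l\<close>, where no union is taken, together
    with the others, so that one choice function \<open>H\<close> serves all levels.\<close>
  have "\<exists>H. min_cost_subset_spanner c G t (T i) H \<and>
          (if i = l then TD i = H else TD i = graph_union (TD (Suc i)) H)" if "i \<in> {1..l}" for i
    using assms(7) that unfolding top_down_output_def by (cases "i = l") auto
  then obtain H where H: "\<And>i. i \<in> {1..l} \<Longrightarrow> min_cost_subset_spanner c G t (T i) (H i) \<and>
          (if i = l then TD i = H i else TD i = graph_union (TD (Suc i)) (H i))"
    by metis
  define m where "m = (\<lambda>i. graph_cost c (H i))"
  have min: "min_cost_subset_spanner c G t (T i) (H i)" if "i \<in> {1..l}" for i
    using H that by blast
  have m_le: "m i \<le> graph_cost c H'"
    if "i \<in> {1..l}" "subset_spanner c G t (T i) H'" for i H'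
    unfolding m_def using min_cost_subset_spanner_le[OF min[OF that(1)] that(2)] .
  have sp: "subset_spanner c G t (T i) (H i)" if "i \<in> {1..l}" for i
    using min_cost_subset_spanner_imp_subset_spanner[OF min[OF that]] .

  have top: "mlgs_cost c l TD \<le> (\<Sum>j=1..l. real j * m j)"
    unfolding m_def
  proof (rule top_down_cost_le[OF _ _ _ fin nonneg])
    show "TD i = graph_union (TD (Suc i)) (H i)" if "i \<in> {1..<l}" for i
      using H[of i] that by simp
    show "TD l = H l"
      using H[of l] assms(4) by simp
    show "edges (H i) \<subseteq> edges G" if "i \<in> {1..l}" for i
      using subset_spanner_edges[OF sp[OF that]] .
  qed

  \<comment> \<open>The spanners \<open>BU 1\<close> and \<open>H 1\<close> may be different
    minimizers; only their costs are compared.\<close>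
  have "min_cost_subset_spanner c G t (T 1) (BU 1)"
    using assms(8) unfolding bottom_up_output_def by blast
  then have "graph_cost c (BU 1) \<le> m 1"
    unfolding m_def using sp[of 1] assms(4) by (simp add: min_cost_subset_spanner_le)
  then have "real l * graph_cost c (BU 1) \<le> real l * m 1"
    by (intro mult_left_mono) auto
  then have bot: "mlgs_cost c l BU \<le> real l * m 1"
    using bottom_up_cost_le[OF assms(8) fin nonneg] by simp

  have "subset_spanner c G t (T i) (Opt i)" if "i \<in> {1..l}" for i
    using assms(9) that unfolding mlgs_optimal_def is_arg_min_linorder mlgs_solution_def by blast
  then have opt: "(\<Sum>j=1..l. m j) \<le> mlgs_cost c l Opt"
    unfolding mlgs_cost_def using m_le by (intro sum_mono) blast

  \<comment> \<open>A spanner for the larger set \<open>T i\<close> also competes in the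
    minimization for \<open>T j\<close>.\<close>
  have anti: "m j \<le> m i" if "1 \<le> i" "i \<le> j" "j \<le> l" for i j
  proof -
    have ij: "i \<in> {1..l}" "j \<in> {1..l}"
      using that by auto
    have "T j \<subseteq> T i"
      using that(2,1,3)
    proof (induction j rule: dec_induct)
      case (step n)
      then show ?case using assms(6)[of n] by auto
    qed simp
    then have "subset_spanner c G t (T j) (H i)"
      by (rule subset_spanner_subset[OF sp[OF ij(1)]])
    then show ?thesis
      using m_le[OF ij(2)] by (simp add: m_def)
  qed

  have "2 * mlgs_cost c l TD + mlgs_cost c l BU
      \<le> 2 * (\<Sum>j=1..l. real j * m j) + real l * m 1"
    using top bot by simp
  also have "\<dots> \<le> (real l + 2) * (\<Sum>j=1..l. m j)"
    using assms(4) anti by (rule weighted_sum_le)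
  also have "\<dots> \<le> (real l + 2) * mlgs_cost c l Opt"
    using opt by (intro mult_left_mono) auto
  \<comment> \<open>Three times the minimum is at most \<open>2 * TOP + BOT\<close>, whence the
    factor \<open>1 / 3\<close>.\<close>
  finally show ?thesis by (simp add: min_def field_simps)
qed

end
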